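(* Let $k \in \mathbb{Z}$ and $n \geq 1$. Then \begin{equation*} \begin{split} C_{n}^{(k)}(x)&=\sum_{l=0}^{n-1} \sum_{l_{1}+\cdots + l_{n}=l}\binom{n-1}{l_{1},\cdots , l_{n},n-1-l}\frac{ B_{l_{1}} \cdots B_{l_{n}}}{(n-l+1)^k}\\ & +\sum_{j=1}^{n}\left\{\sum_{l=0}^{n-j}\sum_{l_{1}+\cdots + l_{n}=l}(-1)^{j}\binom{n-1}{l_{1},\cdots , l_{n},n-1-l}\binom{n-l}{j}\frac{ B_{l_{1}} \cdots B_{l_{n}}}{(n-l-j+1)^k}\right\}x^{j}, \end{split} \end{equation*} where the inner sums run over all $n$-tuples of nonnegative integers $(l_1,\dots,l_n)$ with $l_1+\cdots+l_n=l$.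
   Context: For $k\in\mathbb{Z}$ the polylogarithm factorial function is the formal power series $Lif_k(t)=\sum_{m=0}^{\infty}\frac{t^m}{m!(m+1)^k}$. The poly-Cauchy polynomials of the first kind $C_n^{(k)}(x)$ are defined by the generating function $\frac{Lif_k(\log(1+t))}{(1+t)^x}=\sum_{n=0}^\infty C_n^{(k)}(x)\frac{t^n}{n!}$. $B_l$ denotes the $l$-th Bernoulli number, $\frac{t}{e^t-1}=\sum_{l\ge0}B_l\frac{t^l}{l!}$. The multinomial coefficient is $\binom{n-1}{l_1,\dots,l_n,n-1-l}=\frac{(n-1)!}{l_1!\cdots l_n!\,(n-1-l)!}$ for $l=l_1+\cdots+l_n\le n-1$. *)

theory Defs
  imports "HOL-Computational_Algebra.Formal_Power_Series"
begin

definition Lif :: "int \<Rightarrow> 'a::field_char_0 fps" where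
  "Lif k = Abs_fps (\<lambda>m. 1 / (fact m * of_nat (m + 1) powi k))"

text \<open>
  Here \<^term>\<open>fps_ln 1\<close> is the series of $\log(1+t)$ and \<^term>\<open>fps_binomial x\<close> that of $(1+t)^x$.
  The indeterminate \<open>x\<close> is rendered as an arbitrary element of a field of characteristic 0.
\<close>

definition poly_cauchy :: "nat \<Rightarrow> int \<Rightarrow> 'a::field_char_0 \<Rightarrow> 'a" where
  "poly_cauchy n k x = fact n * fps_nth ((Lif k oo fps_ln 1) / fps_binomial x) n"

definition bernoulli_number :: "nat \<Rightarrow> 'a::field_char_0" where
  "bernoulli_number l = fact l * fps_nth (fps_X / (fps_exp 1 - 1)) l"

text \<open>Meaningful only if \<^term>\<open>sum_list ls = N\<close>.\<close>

definition multinomial :: "nat \<Rightarrow> nat list \<Rightarrow> 'a::field_char_0" where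
  "multinomial N ls = fact N / prod_list (map fact ls)"

definition tuples_with_sum :: "nat \<Rightarrow> nat \<Rightarrow> nat list set" where
  "tuples_with_sum n l = {ls. length ls = n \<and> sum_list ls = l}"

lemma poly_cauchy_gf:
  "Abs_fps (\<lambda>n. poly_cauchy n k x / fact n) = (Lif k oo fps_ln 1) / fps_binomial x"
  by (simp add: poly_cauchy_def fps_eq_iff)

lemma bernoulli_number_gf:
  "Abs_fps (\<lambda>l. bernoulli_number l / fact l) = fps_X / (fps_exp (1::'a::field_char_0) - 1)"
  by (simp add: bernoulli_number_def fps_eq_iff)

end

theory Submission
  imports Defs
begin

unbundle fps_syntax

text \<open>
  Since $(1+t)^{-x} = e^{-x\log(1+t)}$, the generating function of the poly-Cauchy polynomials is
  $F(\log(1+t))$ with $F(u) = Lif_k(u)\,e^{-xu}$. As $\log(1+t)$ is the compositional inverse of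
  $e^u - 1$, Lagrange inversion gives
  $n\,[t^n]F(\log(1+t)) = [u^{n-1}]\,F'(u)\,(u/(e^u-1))^n$. The coefficients of $(u/(e^u-1))^n$ are
  the sums of products of Bernoulli numbers over $n$-tuples, and those of $F$ are binomial sums in $x$.
\<close>

text \<open>Since \<open>f\<close> has zero constant term, \<open>f ^ m\<close> has no coefficient
  below degree \<open>m\<close>. Each inner sum of the composition can therefore run up to
  \<open>k\<close>, independently of \<open>i\<close>, after which the two sums can be
  swapped.\<close>

lemma fps_compose_mult_nth_sum:
  fixes A B f :: "'a::comm_ring_1 fps"
  assumes "f $ 0 = 0"
  shows "((A oo f) * B) $ k = (\<Sum>m=0..k. A $ m * (f ^ m * B) $ k)"
proof -
  have "((A oo f) * B) $ k = (\<Sum>i=0..k. (\<Sum>m=0..i. A $ m * (f ^ m) $ i) * B $ (k - i))"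
    by (simp add: fps_mult_nth fps_compose_nth)
  also have "\<dots> = (\<Sum>i=0..k. (\<Sum>m=0..k. A $ m * (f ^ m) $ i) * B $ (k - i))"
  proof (rule sum.cong[OF refl])
    fix i assume "i \<in> {0..k}"
    then have "(\<Sum>m=0..i. A $ m * (f ^ m) $ i) = (\<Sum>m=0..k. A $ m * (f ^ m) $ i)"
      by (intro sum.mono_neutral_left) (auto simp: startsby_zero_power_prefix[OF assms])
    then show "(\<Sum>m=0..i. A $ m * (f ^ m) $ i) * B $ (k - i)
        = (\<Sum>m=0..k. A $ m * (f ^ m) $ i) * B $ (k - i)"
      by simp
  qed
  also have "\<dots> = (\<Sum>i=0..k. \<Sum>m=0..k. A $ m * ((f ^ m) $ i * B $ (k - i)))"
    by (simp add: sum_distrib_right mult.assoc)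
  also have "\<dots> = (\<Sum>m=0..k. A $ m * (f ^ m * B) $ k)"
    by (subst sum.swap) (simp add: sum_distrib_left fps_mult_nth)
  finally show ?thesis .
qed

text \<open>
  For $m < k$ the series below is, up to the shift by $u^m$, equal to
  $\varphi^p - u(\varphi^p)'/p$ with $p = k - m$, whose $p$-th coefficient vanishes.
\<close>
lemma lagrange_monomial_nth:
  fixes h \<phi> :: "'a::field_char_0 fps"
  assumes inv: "h * \<phi> = 1" and "m \<le> k"
  shows "((fps_X * h) ^ m * (fps_deriv (fps_X * h) * \<phi> ^ Suc k)) $ k = (if m = k then 1 else 0)"
proof -
  define p where "p = k - m"
  have k: "k = m + p"
    using assms by (simp add: p_def)
  have hm: "h ^ i * \<phi> ^ i = 1" for i
    using inv by (metis power_mult_distrib power_one)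
  have "(fps_X * h) ^ m * (fps_deriv (fps_X * h) * \<phi> ^ Suc k)
      = fps_X ^ m * ((h ^ m * \<phi> ^ m) * ((h * \<phi>) * \<phi> ^ p + fps_X * (fps_deriv h * \<phi> ^ Suc p)))"
    by (simp add: k power_add power_mult_distrib algebra_simps)
  also have "\<dots> = fps_X ^ m * (\<phi> ^ p + fps_X * (fps_deriv h * \<phi> ^ Suc p))"
    by (simp add: hm inv)
  finally have eq: "((fps_X * h) ^ m * (fps_deriv (fps_X * h) * \<phi> ^ Suc k)) $ k
      = (\<phi> ^ p + fps_X * (fps_deriv h * \<phi> ^ Suc p)) $ p"
    by (simp add: fps_X_power_mult_nth k)
  show ?thesis
  proof (cases p)
    case 0
    then show ?thesis
      using eq k by simp
  next
    case (Suc q)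
    \<comment> \<open>Differentiating \<open>h * \<phi> = 1\<close> trades the derivative of
      \<open>h\<close> for that of \<open>\<phi>\<close>, which turns the second summand into a
      multiple of the derivative of \<open>\<phi> ^ p\<close>.\<close>
    have "0 = fps_deriv (h * \<phi>)"
      by (simp add: inv)
    then have "fps_deriv h * \<phi> = - (h * fps_deriv \<phi>)"
      by (simp add: algebra_simps eq_neg_iff_add_eq_0)
    moreover have "fps_deriv h * \<phi> ^ Suc p = (fps_deriv h * \<phi>) * (\<phi> * \<phi> ^ q)"
      by (simp add: Suc mult.assoc)
    ultimately have "fps_deriv h * \<phi> ^ Suc p = - ((h * \<phi>) * (fps_deriv \<phi> * \<phi> ^ q))"
      by (simp add: mult_ac)
    then have "fps_deriv h * \<phi> ^ Suc p = - (fps_deriv \<phi> * \<phi> ^ q)"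
      by (simp only: inv mult_1)
    moreover have "fps_deriv (\<phi> ^ p) = of_nat p * (fps_deriv \<phi> * \<phi> ^ q)"
      by (simp only: Suc fps_deriv_power' diff_Suc_1 mult.assoc)
    ultimately have "of_nat p * (fps_deriv h * \<phi> ^ Suc p) = - fps_deriv (\<phi> ^ p)"
      by simp
    \<comment> \<open>Here \<open>p = Suc q\<close>, so differentiation contributes the factor
      \<open>p\<close> again; it is nonzero in characteristic 0 and cancels.\<close>
    then have "(of_nat p * (fps_deriv h * \<phi> ^ Suc p)) $ q = - (of_nat p * (\<phi> ^ p) $ p)"
      by (simp add: Suc del: power_Suc)
    then have "of_nat p * (fps_deriv h * \<phi> ^ Suc p) $ q = of_nat p * (- (\<phi> ^ p) $ p)"
      by (simp add: fps_mult_of_nat_nth)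
    then have "(fps_deriv h * \<phi> ^ Suc p) $ q = - (\<phi> ^ p) $ p"
      using Suc by (simp only: mult_cancel_left of_nat_eq_0_iff) simp
    then show ?thesis
      using eq k Suc by (simp del: power_Suc)
  qed
qed

text \<open>The chain rule and expansion in powers of \<open>fps_X * h\<close> leave only the term
  \<open>m = k\<close>, by \<open>lagrange_monomial_nth\<close>. Taking \<open>G\<close> itself as
  the unknown avoids naming the compositional inverse of \<open>fps_X * h\<close>.\<close>

theorem fps_lagrange_inversion:
  fixes G h \<phi> :: "'a::field_char_0 fps"
  assumes "h * \<phi> = 1"
  shows "of_nat (Suc k) * G $ Suc k = (fps_deriv (G oo (fps_X * h)) * \<phi> ^ Suc k) $ k"
proof -
  have "(fps_deriv (G oo (fps_X * h)) * \<phi> ^ Suc k) $ k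
      = ((fps_deriv G oo (fps_X * h)) * (fps_deriv (fps_X * h) * \<phi> ^ Suc k)) $ k"
    by (subst fps_compose_deriv) (simp_all add: mult.assoc)
  also have "\<dots> = (\<Sum>m=0..k. fps_deriv G $ m * (if m = k then 1 else 0))"
    by (subst fps_compose_mult_nth_sum)
       (auto intro!: sum.cong simp: lagrange_monomial_nth[OF assms] simp del: power_Suc fps_deriv_mult)
  also have "\<dots> = of_nat (Suc k) * G $ Suc k"
    by (simp add: if_distrib[of "(*) _"] cong: if_cong)
  finally show ?thesis ..
qed

text \<open>Both sides solve $(1+t)y' = cy$ with $y(0) = 1$, and the solution is unique.\<close>

lemma fps_binomial_eq_exp_compose_ln:
  "fps_binomial c = fps_exp (c::'a::field_char_0) oo fps_ln 1"
proof -
  have "fps_deriv (fps_exp c oo fps_ln 1) = fps_const c * (fps_exp c oo fps_ln 1) / (1 + fps_X)"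
    by (simp add: fps_compose_deriv fps_ln_deriv fps_divide_unit fps_compose_mult_distrib)
  then show ?thesis
    using fps_binomial_ODE_unique'[of "fps_exp c oo fps_ln 1" c] by simp
qed

lemma inverse_fps_binomial: "inverse (fps_binomial (c::'a::field_char_0)) = fps_binomial (- c)"
  by (rule fps_inverse_unique) (simp flip: fps_binomial_add_mult)

lemma fps_ln_compose_exp_minus_one: "fps_ln (1::'a::field_char_0) oo (fps_exp 1 - 1) = fps_X"
  by (simp add: fps_ln_fps_exp_inv fps_inv)

lemma fps_exp_minus_one_eq: "fps_exp (1::'a::field_char_0) - 1 = fps_X * fps_shift 1 (fps_exp 1)"
  by (rule fps_ext) (simp add: fps_X_mult_nth)

text \<open>The series $e^u - 1$ is not a unit, so the common factor \<open>fps_X\<close> is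
  cancelled first; what remains is the reciprocal of a series with constant term 1.\<close>

lemma bernoulli_gf_inverse:
  "fps_shift 1 (fps_exp 1) * (fps_X / (fps_exp (1::'a::field_char_0) - 1)) = 1"
proof -
  let ?h = "fps_shift 1 (fps_exp 1) :: 'a fps"
  have "fps_X / (fps_exp (1::'a) - 1) = (fps_X * 1) / (fps_X * ?h)"
    by (simp add: fps_exp_minus_one_eq)
  also have "\<dots> = 1 / ?h"
    by (rule div_mult_mult1) simp
  finally show ?thesis
    by (simp add: fps_divide_unit inverse_mult_eq_1')
qed

lemma fps_power_nth_tuples:
  fixes a :: "'a::comm_ring_1 fps"
  shows "(a ^ n) $ l = (\<Sum>ls\<in>tuples_with_sum n l. prod_list (map (($) a) ls))"
proof (cases n)
  case 0
  moreover have "tuples_with_sum 0 l = (if l = 0 then {[]} else {})"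
    by (auto simp: tuples_with_sum_def)
  ultimately show ?thesis
    by simp
next
  case (Suc m)
  have "(a ^ n) $ l = (\<Sum>v\<in>natpermute l n. \<Prod>j=0..m. a $ (v ! j))"
    by (simp add: Suc fps_power_nth del: power_Suc)
  also have "natpermute l n = tuples_with_sum n l"
    by (auto simp: natpermute_def tuples_with_sum_def)
  also have "(\<Sum>v\<in>tuples_with_sum n l. \<Prod>j=0..m. a $ (v ! j))
      = (\<Sum>ls\<in>tuples_with_sum n l. prod_list (map (($) a) ls))"
    by (intro sum.cong)
       (auto simp: tuples_with_sum_def Suc prod.list_conv_set_nth atLeastLessThanSuc_atLeastAtMost)
  finally show ?thesis .
qed

lemma prod_list_map_bernoulli_number:
  "prod_list (map bernoulli_number ls)
    = prod_list (map fact ls) * prod_list (map (($) (fps_X / (fps_exp (1::'a::field_char_0) - 1))) ls)"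
  by (induction ls) (simp_all add: bernoulli_number_def algebra_simps)

text \<open>The factorials in the Bernoulli numbers cancel those of the multinomial coefficient,
  except for that of the last entry \<open>r\<close>, which does not depend on the tuple.\<close>

lemma sum_multinomial_bernoulli:
  "(\<Sum>ls\<in>tuples_with_sum n l. multinomial N (ls @ [r]) * prod_list (map bernoulli_number ls))
    = fact N / fact r * ((fps_X / (fps_exp (1::'a::field_char_0) - 1)) ^ n) $ l"
proof -
  have nz: "prod_list (map fact ls) \<noteq> (0::'a)" for ls :: "nat list"
    by (induction ls) auto
  show ?thesis
    by (simp add: fps_power_nth_tuples sum_distrib_left prod_list_map_bernoulli_number
        multinomial_def nz field_simps)
qed

lemma fact_times_Lif_exp_nth:
  "fact m * (Lif k * fps_exp (- x)) $ m
    = (\<Sum>j=0..m. (-1) ^ j * of_nat (m choose j) * x ^ j / of_nat (m - j + 1) powi k)"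
  for x :: "'a::field_char_0"
proof -
  have "fact m * (Lif k * fps_exp (- x)) $ m = fact m * (fps_exp (- x) * Lif k) $ m"
    by (simp add: mult.commute)
  also have "\<dots> = (\<Sum>j=0..m. fact m * ((- x) ^ j / fact j *
      (1 / (fact (m - j) * of_nat (m - j + 1) powi k))))"
    by (simp add: fps_mult_nth Lif_def sum_distrib_left)
  also have "\<dots> = (\<Sum>j=0..m. (-1) ^ j * of_nat (m choose j) * x ^ j / of_nat (m - j + 1) powi k)"
    by (intro sum.cong refl) (simp add: binomial_fact power_minus[of x] mult_ac)
  finally show ?thesis .
qed

text \<open>The factorials are grouped so that \<open>sum_multinomial_bernoulli\<close> with
  \<open>r = N - l\<close> and \<open>fact_times_Lif_exp_nth\<close> with
  \<open>m = Suc N - l\<close> apply to the two factors.\<close>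

lemma poly_cauchy_eq_lagrange:
  fixes x :: "'a::field_char_0"
  shows "poly_cauchy (Suc N) k x = (\<Sum>l=0..N.
    fact N / fact (N - l) * ((fps_X / (fps_exp 1 - 1)) ^ Suc N) $ l *
    (fact (Suc N - l) * (Lif k * fps_exp (- x)) $ (Suc N - l)))"
proof -
  let ?F = "Lif k * fps_exp (- x) :: 'a fps"
  let ?\<phi> = "fps_X / (fps_exp 1 - 1) :: 'a fps"
  define G where "G = ?F oo fps_ln 1"
  have G: "(Lif k oo fps_ln 1) / fps_binomial x = G"
    by (simp add: G_def fps_divide_unit inverse_fps_binomial fps_compose_mult_distrib
        fps_binomial_eq_exp_compose_ln[of "- x"])
  \<comment> \<open>Substituting $e^u - 1$ for $t$ undoes the logarithm.\<close>
  have "G oo (fps_exp 1 - 1) = ?F"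
    by (simp add: G_def fps_ln_compose_exp_minus_one flip: fps_compose_assoc)
  then have GF: "G oo (fps_X * fps_shift 1 (fps_exp 1)) = ?F"
    by (simp only: fps_exp_minus_one_eq)
  have "poly_cauchy (Suc N) k x = fact N * (of_nat (Suc N) * G $ Suc N)"
    by (simp add: poly_cauchy_def G algebra_simps)
  also have "\<dots> = fact N * (?\<phi> ^ Suc N * fps_deriv ?F) $ N"
    by (simp only: fps_lagrange_inversion[OF bernoulli_gf_inverse] GF mult.commute)
  also have "\<dots> = (\<Sum>l=0..N. fact N * ((?\<phi> ^ Suc N) $ l * fps_deriv ?F $ (N - l)))"
    by (simp only: fps_mult_nth sum_distrib_left)
  also have "\<dots> = (\<Sum>l=0..N. fact N / fact (N - l) * (?\<phi> ^ Suc N) $ l *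
      (fact (Suc N - l) * ?F $ (Suc N - l)))"
  proof (intro sum.cong refl)
    fix l assume "l \<in> {0..N}"
    then have l: "Suc N - l = Suc (N - l)"
      by auto
    show "fact N * ((?\<phi> ^ Suc N) $ l * fps_deriv ?F $ (N - l)) =
        fact N / fact (N - l) * (?\<phi> ^ Suc N) $ l * (fact (Suc N - l) * ?F $ (Suc N - l))"
      \<comment> \<open>The derivative contributes the factor $N-l+1$, which equals
        $(N-l+1)!/(N-l)!$.\<close>
      unfolding l by (simp del: power_Suc fps_deriv_mult)
  qed
  finally show ?thesis .
qed

theorem theorem1:
  fixes k :: int and n :: nat and x :: "'a::field_char_0"
  assumes "n \<ge> 1"
  shows "poly_cauchy n k x =
    (\<Sum>l=0..n-1. \<Sum>ls\<in>tuples_with_sum n l.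
        multinomial (n - 1) (ls @ [n - 1 - l]) *
        (prod_list (map bernoulli_number ls) / of_nat (n - l + 1) powi k))
    + (\<Sum>j=1..n.
        (\<Sum>l=0..n-j. \<Sum>ls\<in>tuples_with_sum n l.
            (-1) ^ j * multinomial (n - 1) (ls @ [n - 1 - l]) * of_nat ((n - l) choose j) *
            (prod_list (map bernoulli_number ls) / of_nat (n - l - j + 1) powi k))
        * x ^ j)"
proof -
  define S :: "nat \<Rightarrow> 'a" where
    "S l = (\<Sum>ls\<in>tuples_with_sum n l.
      multinomial (n - 1) (ls @ [n - 1 - l]) * prod_list (map bernoulli_number ls))" for l
  define T :: "nat \<Rightarrow> nat \<Rightarrow> 'a" where
    "T l j = (-1) ^ j * of_nat ((n - l) choose j) * x ^ j / of_nat (n - l - j + 1) powi k" for l j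
  have first: "(\<Sum>ls\<in>tuples_with_sum n l. multinomial (n - 1) (ls @ [n - 1 - l]) *
      (prod_list (map bernoulli_number ls) / of_nat (n - l + 1) powi k)) = S l * T l 0" for l
    by (simp add: S_def T_def sum_divide_distrib)
  have second: "(\<Sum>l=0..n-j. \<Sum>ls\<in>tuples_with_sum n l.
      (-1) ^ j * multinomial (n - 1) (ls @ [n - 1 - l]) * of_nat ((n - l) choose j) *
      (prod_list (map bernoulli_number ls) / of_nat (n - l - j + 1) powi k)) * x ^ j
      = (\<Sum>l=0..n-j. S l * T l j)" for j
    unfolding S_def T_def sum_distrib_right
    by (intro sum.cong refl) (simp add: mult_ac)
  have "poly_cauchy n k x = (\<Sum>l=0..n-1. S l * (\<Sum>j=0..n-l. T l j))"
    using assms poly_cauchy_eq_lagrange[of "n - 1" k x]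
    by (simp add: S_def T_def sum_multinomial_bernoulli fact_times_Lif_exp_nth)
  \<comment> \<open>The terms with \<open>j = 0\<close> form the part free of
    \<open>x\<close>.\<close>
  also have "\<dots> = (\<Sum>l=0..n-1. S l * T l 0 + (\<Sum>j=1..n-l. S l * T l j))"
    by (simp add: sum.atLeast_Suc_atMost distrib_left sum_distrib_left)
  also have "\<dots> = (\<Sum>l=0..n-1. S l * T l 0) + (\<Sum>l=0..n-1. \<Sum>j=1..n-l. S l * T l j)"
    by (rule sum.distrib)
  also have "(\<Sum>l=0..n-1. \<Sum>j=1..n-l. S l * T l j) = (\<Sum>j=1..n. \<Sum>l=0..n-j. S l * T l j)"
    unfolding sum.Sigma[OF finite_atLeastAtMost ballI[OF finite_atLeastAtMost]]
    by (rule sum.reindex_bij_witness[of _ prod.swap prod.swap]) auto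
  finally show ?thesis
    by (simp only: first second)
qed

end
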